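(* Let $d>2$ be an even integer and $\lambda=\frac{d-2}{2}$. There is a constant $c>0$ such that the following holds. Let $f\in L^2(\mathbb{R}^d)\otimes\mathbb{R}_d$ and let $g\in W_{2\lambda}(\mathbb{R}^d)$ be a (real-valued) radial function, with $\|f\|_2=\|g\|_{W_{2\lambda}}=1$. Let $U\subseteq\mathbb{R}^{2d}$ be an open set and $\varepsilon\ge0$ such that $$\iint_U(1+|\underline x|)^{-2\lambda}(1+|\underline\omega|)^{-2\lambda}|\mathcal{V}_gf(x,\omega)|^2\,dx\,d\omega\ge1-\varepsilon.$$ Then $|U|\ge(1-\varepsilon)\frac1c$, where $|U|$ is the Lebesgue measure of $U$.
   Context: $\mathbb{R}_d$ is the real Clifford algebra generated by $e_1,\dots,e_d$ with $e_je_k+e_ke_j=-2\delta_{jk}$; a vector $x\in\mathbb{R}^d$ is identified with $\underline{x}=\sum_j x_je_j$, with Euclidean norm $|\underline{x}|$, and $\underline{x}\wedge\underline{y}=\sum_{j<k}e_je_k(x_jy_k-x_ky_j)$. For $a=\sum_A a_Ae_A\in\mathbb{R}_d$, $|a|=(\sum_A a_A^2)^{1/2}$. $L^2(\mathbb{R}^d)\otimes\mathbb{R}_d$ is the space of $f:\mathbb{R}^d\to\mathbb{R}_d$ with $\|f\|_2^2=\int|f|^2<\infty$. Radial means $g(x)=g_0(|\underline{x}|)$ with $g_0$ real-valued. $W_{2\lambda}(\mathbb{R}^d)$ is the space of real-valued $g\in L^2(\mathbb{R}^d)$ with $\|g\|_{W_{2\lambda}}=\left(\int_{\mathbb{R}^d}(1+|\underline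 y|)^{2\lambda}|g(y)|^2dy\right)^{1/2}<\infty$. Put $\lambda=\frac{d-2}{2}$. For $d$ even the Clifford-Fourier kernel $K_-(x,y)=e^{i\frac{\pi}{2}\Gamma_{\underline y}}e^{-i\langle\underline x,\underline y\rangle}$ (where $\Gamma_{\underline y}=-\sum_{j<k}e_je_k(y_j\partial_{y_k}-y_k\partial_{y_j})$) is the $\mathbb{R}_d$-valued function $$K_-(x,y)=(-1)^{\lambda+1}\left(\tfrac{\pi}{2}\right)^{1/2}\left(A^*_\lambda(s,t)+B^*_\lambda(s,t)+(\underline x\wedge\underline y)C^*_\lambda(s,t)\right),$$ with $s=\langle\underline x,\underline y\rangle=\sum_j x_jy_j$, $t=\sqrt{|\underline x|^2|\underline y|^2-s^2}$, $\tilde J_\alpha(t)=t^{-\alpha}J_\alpha(t)$ ($J_\alpha$ the Bessel function; value at $t=0$ by continuity), and $A^*_\lambda=\sum_{l=0}^{\lfloor\frac{\lambda+1}{2}-\frac34\rfloor}s^{\lambda-1-2l}\frac{1}{2^ll!}\frac{\Gamma(\lambda+1)}{\Gamma(\lambda-2l)}\tilde J_{(2\lambda-2l-1)/2}(t)$, $B^*_\lambda=-\sum_{l=0}^{\lfloor\lambda/2\rfloor}s^{\lambda-2l}\frac{1}{2^ll!}\frac{\Gamma(\lambda+1)}{\Gamma(\lambda-2l+1)}\tilde J_{(2\lambda-2l-1)/2}(t)$, $C^*_\lambda=-\sum_{l=0}^{\lfloor\lambda/2\rfloor}s^{\lambda-2l}\frac{1}{2^ll!}\frac{\Gamma(\lambda+1)}{\Gamma(\lambda-2l+1)}\tilde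 J_{(2\lambda-2l+1)/2}(t)$. The Clifford short-time Fourier transform of $f$ with radial window $g$ is $$\mathcal{V}_gf(x,\omega)=(2\pi)^{-\frac d2}\int_{\mathbb{R}^d}K_-(t,\omega)\,g(t-x)\,f(t)\,dt,\qquad x,\omega\in\mathbb{R}^d.$$ *)

theory Defs
  imports "HOL-Analysis.Analysis"
begin

text \<open>
  The dimension d is \<open>CARD('n)\<close>; the linear order on the index type \<open>'n\<close> orders the
  generators \<open>e_j\<close>.  For \<open>A = {j_1 < \<dots> < j_k}\<close> let \<open>e_A = e_{j_1} \<cdots> e_{j_k}\<close>; an element is the
  vector of its coefficients in the basis \<open>(e_A)\<close>, so that \<^const>\<open>norm\<close> is the norm
  \<open>(\<Sum>A. a_A^2)^(1/2)\<close>.  Beware that \<open>*\<close> on \<^typ>\<open>real ^ 'n set\<close> is componentwise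
  multiplication, not the product of the algebra.
\<close>

type_synonym 'n clifford = "real ^ 'n set"

definition cbasis :: "'n::finite set \<Rightarrow> 'n clifford"
  where "cbasis A = axis A 1"

text \<open>
  Sorting the word \<open>e_A e_B\<close> costs one sign for each pair \<open>a \<in> A\<close>, \<open>b \<in> B\<close> with \<open>b < a\<close>
  (anticommutation) and one for each common index (\<open>e_a e_a = -1\<close>).
\<close>

definition clifford_sign :: "'n::{finite,linorder} set \<Rightarrow> 'n set \<Rightarrow> real"
  where "clifford_sign A B = (-1) ^ card {(a, b). a \<in> A \<and> b \<in> B \<and> b \<le> a}"

definition cmul :: "'n::{finite,linorder} clifford \<Rightarrow> 'n clifford \<Rightarrow> 'n clifford"
    (infixl \<open>\<star>\<close> 70)
  where "a \<star> b =
    (\<Sum>A\<in>UNIV. \<Sum>B\<in>UNIV. (a $ A * b $ B * clifford_sign A B) *\<^sub>R cbasis (sym_diff A B))"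

abbreviation cgen :: "'n::finite \<Rightarrow> 'n clifford"
  where "cgen j \<equiv> cbasis {j}"

abbreviation cscalar :: "real \<Rightarrow> 'n::finite clifford"
  where "cscalar r \<equiv> r *\<^sub>R cbasis {}"

lemma cmul_cbasis:
  "cbasis A \<star> cbasis B = clifford_sign A B *\<^sub>R cbasis (sym_diff A B)"
proof -
  have "cbasis A \<star> cbasis B =
    (\<Sum>A'\<in>UNIV. \<Sum>B'\<in>UNIV. if A' = A then (if B' = B
       then clifford_sign A B *\<^sub>R cbasis (sym_diff A B) else 0) else 0)"
    unfolding cmul_def by (intro sum.cong refl) (auto simp: cbasis_def axis_def)
  also have "\<dots> = (\<Sum>A'\<in>UNIV. if A' = A then (\<Sum>B'\<in>UNIV. if B' = B
       then clifford_sign A B *\<^sub>R cbasis (sym_diff A B) else 0) else 0)"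
    by (intro sum.cong refl) auto
  finally show ?thesis by simp
qed

lemma cgen_anticommute:
  "cgen j \<star> cgen k + cgen k \<star> cgen j = cscalar (-2 * (if j = k then 1 else 0))"
proof -
  have s: "clifford_sign {a} {b} = (if b \<le> a then -1 else 1)" for a b :: 'a
  proof -
    have "{(a', b'). a' \<in> {a} \<and> b' \<in> {b} \<and> b' \<le> a'} = (if b \<le> a then {(a, b)} else {})"
      by auto
    then show ?thesis by (simp add: clifford_sign_def)
  qed
  show ?thesis
    by (auto simp: cmul_cbasis s insert_commute Un_commute simp flip: scaleR_left_distrib)
qed

lemma clifford_sign_prod:
  "clifford_sign A B = (\<Prod>a\<in>A. \<Prod>b\<in>B. if b \<le> a then -1 else 1)"
proof -
  have "(\<Prod>a\<in>A. \<Prod>b\<in>B. if b \<le> a then -1 else (1::real)) =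
      (\<Prod>(a, b)\<in>A \<times> B. if b \<le> a then -1 else 1)"
    by (simp add: prod.cartesian_product)
  also have "\<dots> = (\<Prod>p\<in>{(a, b). a \<in> A \<and> b \<in> B \<and> b \<le> a}. -1)"
    by (rule prod.mono_neutral_cong_right) (auto split: if_splits)
  finally show ?thesis by (simp add: clifford_sign_def)
qed

lemma prod_sym_diff:
  fixes f :: "'a::finite \<Rightarrow> real"
  assumes "\<And>x. f x * f x = 1"
  shows "prod f (sym_diff A B) = prod f A * prod f B"
proof -
  have 1: "prod f A = prod f (A - B) * prod f (A \<inter> B)"
    by (subst prod.union_disjoint[symmetric]) (auto intro: prod.cong)
  have 2: "prod f B = prod f (B - A) * prod f (A \<inter> B)"
    by (subst prod.union_disjoint[symmetric]) (auto intro: prod.cong)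
  have 3: "prod f (A \<inter> B) * prod f (A \<inter> B) = 1"
    by (simp add: assms flip: prod.distrib)
  have "prod f (sym_diff A B) = prod f (A - B) * prod f (B - A)"
    by (rule prod.union_disjoint) auto
  then show ?thesis using 1 2 3 by (simp add: algebra_simps)
qed

lemma clifford_sign_sym_diff_left:
  "clifford_sign (sym_diff A B) C = clifford_sign A C * clifford_sign B C"
  unfolding clifford_sign_prod
  by (rule prod_sym_diff) (auto simp flip: prod.distrib intro!: prod.neutral)

lemma clifford_sign_sym_diff_right:
  "clifford_sign A (sym_diff B C) = clifford_sign A B * clifford_sign A C"
proof -
  have "(\<Prod>b\<in>sym_diff B C. if b \<le> a then -1 else (1::real)) =
     (\<Prod>b\<in>B. if b \<le> a then -1 else 1) * (\<Prod>b\<in>C. if b \<le> a then -1 else 1)" for a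
    by (rule prod_sym_diff) auto
  then show ?thesis
    unfolding clifford_sign_prod by (simp add: prod.distrib)
qed

lemma cmul_cbasis_assoc:
  "(cbasis A \<star> cbasis B) \<star> cbasis C = cbasis A \<star> (cbasis B \<star> cbasis C)"
proof -
  have l: "(r *\<^sub>R a) \<star> b = r *\<^sub>R (a \<star> b)" and r: "a \<star> (r *\<^sub>R b) = r *\<^sub>R (a \<star> b)"
    for r and a b :: "'a clifford"
    by (simp_all add: cmul_def scaleR_sum_right mult.assoc mult.left_commute)
  have "sym_diff (sym_diff A B) C = sym_diff A (sym_diff B C)" by blast
  then show ?thesis
    by (simp only: cmul_cbasis l r clifford_sign_sym_diff_left clifford_sign_sym_diff_right
        scaleR_scaleR mult_ac)
qed

definition wedge :: "real ^ ('n::{finite,linorder}) \<Rightarrow> real ^ ('n::{finite,linorder}) \<Rightarrow> 'n clifford"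
  where "wedge x y =
    (\<Sum>(j, k) | j < k. (x $ j * y $ k - x $ k * y $ j) *\<^sub>R (cgen j \<star> cgen k))"

text \<open>The series is \<open>J_\<alpha>(t)\<close> for \<open>t > 0\<close> only, since \<open>powr\<close> is used with a real exponent.\<close>

definition bessel_J :: "real \<Rightarrow> real \<Rightarrow> real"
  where "bessel_J \<alpha> t =
    (\<Sum>m. (-1) ^ m / (fact m * Gamma (real m + \<alpha> + 1)) * (t / 2) powr (2 * real m + \<alpha>))"

definition bessel_Jt :: "real \<Rightarrow> real \<Rightarrow> real"
  where "bessel_Jt \<alpha> t =
    (if t = 0 then Lim (at_right 0) (\<lambda>u. u powr (-\<alpha>) * bessel_J \<alpha> u)
     else t powr (-\<alpha>) * bessel_J \<alpha> t)"

text \<open>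
  For \<open>lam \<ge> 1\<close>, the exponents of \<open>s\<close> are non-negative throughout the ranges of
  the three sums below, so the subtraction of natural numbers is never truncated.
\<close>

definition A_star :: "nat \<Rightarrow> real \<Rightarrow> real \<Rightarrow> real"
  where "A_star lam s t =
    (\<Sum>l\<in>{0..nat \<lfloor>(real lam + 1) / 2 - 3 / 4\<rfloor>}.
       s ^ (lam - 1 - 2 * l) * (1 / (2 ^ l * fact l))
       * (Gamma (real lam + 1) / Gamma (real lam - 2 * real l))
       * bessel_Jt ((2 * real lam - 2 * real l - 1) / 2) t)"

definition B_star :: "nat \<Rightarrow> real \<Rightarrow> real \<Rightarrow> real"
  where "B_star lam s t =
    - (\<Sum>l\<in>{0..nat \<lfloor>real lam / 2\<rfloor>}.
       s ^ (lam - 2 * l) * (1 / (2 ^ l * fact l))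
       * (Gamma (real lam + 1) / Gamma (real lam - 2 * real l + 1))
       * bessel_Jt ((2 * real lam - 2 * real l - 1) / 2) t)"

definition C_star :: "nat \<Rightarrow> real \<Rightarrow> real \<Rightarrow> real"
  where "C_star lam s t =
    - (\<Sum>l\<in>{0..nat \<lfloor>real lam / 2\<rfloor>}.
       s ^ (lam - 2 * l) * (1 / (2 ^ l * fact l))
       * (Gamma (real lam + 1) / Gamma (real lam - 2 * real l + 1))
       * bessel_Jt ((2 * real lam - 2 * real l + 1) / 2) t)"

text \<open>\<open>\<lambda> = (d - 2) / 2\<close>; the division is exact since d is even.\<close>

definition cf_lambda :: "'n::finite itself \<Rightarrow> nat"
  where "cf_lambda _ = (CARD('n) - 2) div 2"

text \<open>
  The closed form, for even d, of the kernel \<open>exp(i (\<pi>/2) \<Gamma>_y) exp(-i \<langle>x, y\<rangle>)\<close>.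
\<close>

definition cf_kernel :: "real ^ ('n::{finite,linorder}) \<Rightarrow> real ^ ('n::{finite,linorder}) \<Rightarrow> 'n clifford"
  where "cf_kernel x y =
    (let lam = cf_lambda TYPE('n);
         s = x \<bullet> y;
         t = sqrt ((norm x)\<^sup>2 * (norm y)\<^sup>2 - s\<^sup>2)
     in ((-1) ^ (lam + 1) * sqrt (pi / 2)) *\<^sub>R
          (cscalar (A_star lam s t + B_star lam s t) + C_star lam s t *\<^sub>R wedge x y))"

definition L2 :: "('a::euclidean_space \<Rightarrow> 'b::euclidean_space) set"
  where "L2 = {f. f \<in> borel_measurable lebesgue \<and> integrable lebesgue (\<lambda>x. (norm (f x))\<^sup>2)}"

definition L2_norm :: "('a::euclidean_space \<Rightarrow> 'b::euclidean_space) \<Rightarrow> real"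
  where "L2_norm f = sqrt (LINT x|lebesgue. (norm (f x))\<^sup>2)"

definition W_space :: "real \<Rightarrow> ('a::euclidean_space \<Rightarrow> real) set"
  where "W_space \<mu> =
    {g \<in> L2. integrable lebesgue (\<lambda>y. (1 + norm y) powr \<mu> * \<bar>g y\<bar>\<^sup>2)}"

definition W_norm :: "real \<Rightarrow> ('a::euclidean_space \<Rightarrow> real) \<Rightarrow> real"
  where "W_norm \<mu> g = sqrt (LINT y|lebesgue. (1 + norm y) powr \<mu> * \<bar>g y\<bar>\<^sup>2)"

definition radial :: "('a::real_normed_vector \<Rightarrow> real) \<Rightarrow> bool"
  where "radial g \<longleftrightarrow> (\<exists>g0 :: real \<Rightarrow> real. \<forall>x. g x = g0 (norm x))"

definition cstft :: "(real ^ ('n::{finite,linorder}) \<Rightarrow> real) \<Rightarrow> (real ^ ('n::{finite,linorder}) \<Rightarrow> 'n clifford) \<Rightarrow>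
    real ^ ('n::{finite,linorder}) \<Rightarrow> real ^ ('n::{finite,linorder}) \<Rightarrow> 'n clifford"
  where "cstft g f x \<omega> =
    (2 * pi) powr (- (real CARD('n) / 2)) *\<^sub>R
      (LINT t|lebesgue. cf_kernel t \<omega> \<star> (g (t - x) *\<^sub>R f t))"

end

theory Submission
  imports Defs
begin

text \<open>
  The kernel satisfies \<open>|K_-(x,y)| \<le> C ((1 + |x|) (1 + |y|))^\<lambda>\<close>: its Bessel functions have
  half-integer order, hence are bounded and decay like \<open>1 / t\<close>, and the decay absorbs
  the wedge product, whose norm is at most a multiple of \<open>t\<close> by Lagrange's identity.
  Splitting \<open>1 + |t| \<le> (1 + |x|) (1 + |t - x|)\<close> and moving the second factor to the window,
  one obtains \<open>|V_g f(x,\<omega>)| \<le> C' ((1 + |x|) (1 + |\<omega>|))^\<lambda>\<close>.  The weighted integrand is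
  therefore at most \<open>C'^2\<close>, and its integral over \<open>U\<close> at most \<open>C'^2 |U|\<close>.
\<close>

section \<open>Bessel functions of half-integer order\<close>

text \<open>With \<open>rGamma\<close> instead of \<open>1 / Gamma\<close> the recurrence holds at the poles as well.\<close>

definition bessel_series :: "real \<Rightarrow> real \<Rightarrow> real"
  where "bessel_series \<alpha> u = (\<Sum>m. (- u) ^ m / fact m * rGamma (real m + \<alpha> + 1))"

text \<open>Ratio test. Once m >= 2 |u| + |\<alpha>|, the factor |u| / (m + 1) is at most 1/2, and
  \<open>rGamma\<close> does not grow in modulus from one term to the next because m + \<alpha> + 1
  >= 1.\<close>

lemma summable_bessel_series:
  fixes \<alpha> u :: real
  shows "summable (\<lambda>m. (- u) ^ m / fact m * rGamma (real m + \<alpha> + 1))"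
proof (rule summable_ratio_test)
  show "(1/2 :: real) < 1" by simp
  fix m :: nat
  assume m: "nat \<lceil>2 * \<bar>u\<bar> + \<bar>\<alpha>\<bar>\<rceil> \<le> m"
  then have m: "2 * \<bar>u\<bar> + \<bar>\<alpha>\<bar> \<le> real m" by linarith
  have rec: "rGamma (real m + \<alpha> + 1) = (real m + \<alpha> + 1) * rGamma (real (Suc m) + \<alpha> + 1)"
    using rGamma_plus1[of "real m + \<alpha> + 1"] by (simp add: algebra_simps)
  have "1 * \<bar>rGamma (real (Suc m) + \<alpha> + 1)\<bar> \<le> \<bar>real m + \<alpha> + 1\<bar> * \<bar>rGamma (real (Suc m) + \<alpha> + 1)\<bar>"
    by (rule mult_right_mono) (use m in linarith)+
  then have g: "\<bar>rGamma (real (Suc m) + \<alpha> + 1)\<bar> \<le> \<bar>rGamma (real m + \<alpha> + 1)\<bar>"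
    unfolding rec by (simp add: abs_mult)
  have "\<bar>u\<bar> / real (Suc m) \<le> 1/2"
    using m by (simp add: field_simps)
  then have "\<bar>u\<bar> / real (Suc m) * (\<bar>u\<bar> ^ m / fact m) \<le> 1/2 * (\<bar>u\<bar> ^ m / fact m)"
    by (rule mult_right_mono) simp
  then have "\<bar>u\<bar> ^ Suc m / fact (Suc m) \<le> 1/2 * (\<bar>u\<bar> ^ m / fact m)"
    by (simp add: field_simps)
  then have "\<bar>u\<bar> ^ Suc m / fact (Suc m) * \<bar>rGamma (real (Suc m) + \<alpha> + 1)\<bar>
      \<le> 1/2 * (\<bar>u\<bar> ^ m / fact m) * \<bar>rGamma (real m + \<alpha> + 1)\<bar>"
    by (rule mult_mono[OF _ g]) simp_all
  then show "norm ((- u) ^ Suc m / fact (Suc m) * rGamma (real (Suc m) + \<alpha> + 1))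
      \<le> 1/2 * norm ((- u) ^ m / fact m * rGamma (real m + \<alpha> + 1))"
    by (simp add: abs_mult power_abs del: power_Suc fact_Suc of_nat_Suc)
qed

text \<open>This is the classical identity J_{\<alpha>-1} + J_{\<alpha>+1} = (2 \<alpha> / t)
  J_\<alpha>, freed of powers of t by J_\<alpha>(t) = (t/2)^\<alpha> \<open>bessel_series\<close>
  \<alpha> (t^2/4) and u = t^2/4. It holds coefficientwise after a shift of the index by
  one.\<close>

lemma bessel_series_recurrence:
  "u * bessel_series (\<alpha> + 1) u = \<alpha> * bessel_series \<alpha> u - bessel_series (\<alpha> - 1) u"
proof -
  define a where "a \<beta> m = (- u) ^ m / fact m * rGamma (real m + \<beta> + 1)" for \<beta> m
  have s: "summable (a \<beta>)" for \<beta>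
    using summable_bessel_series[of u \<beta>] by (simp add: a_def[abs_def])
  have ser: "bessel_series \<beta> u = suminf (a \<beta>)" for \<beta>
    unfolding bessel_series_def by (rule arg_cong[of _ _ suminf]) (simp add: a_def fun_eq_iff)
  have rg: "rGamma (real m + \<alpha>) = (real m + \<alpha>) * rGamma (real m + \<alpha> + 1)" for m
    using rGamma_plus1[of "real m + \<alpha>"] by simp
  have d: "\<alpha> * a \<alpha> m - a (\<alpha> - 1) m = - (real m * ((- u) ^ m / fact m) * rGamma (real m + \<alpha> + 1))" for m
    unfolding a_def by (simp add: rg) (simp add: algebra_simps add_divide_distrib)
  have sd: "summable (\<lambda>m. \<alpha> * a \<alpha> m - a (\<alpha> - 1) m)"
    by (intro summable_diff summable_mult s)
  have "\<alpha> * bessel_series \<alpha> u - bessel_series (\<alpha> - 1) u = (\<Sum>m. \<alpha> * a \<alpha> m - a (\<alpha> - 1) m)"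
    unfolding ser by (simp only: suminf_mult[OF s, symmetric] suminf_diff[OF summable_mult[OF s] s])
  \<comment> \<open>By \<open>d\<close> the term of index m carries the factor m, so the head
    vanishes; in the shifted series this factor cancels against the factorial.\<close>
  also have "\<dots> = (\<Sum>m. \<alpha> * a \<alpha> (Suc m) - a (\<alpha> - 1) (Suc m))"
    using suminf_split_head[OF sd] by (simp add: d)
  also have "(\<lambda>m. \<alpha> * a \<alpha> (Suc m) - a (\<alpha> - 1) (Suc m)) = (\<lambda>m. u * a (\<alpha> + 1) m)"
  proof
    fix m
    have "real (Suc m) * ((- u) ^ Suc m / fact (Suc m)) = - u * ((- u) ^ m / fact m)"
      by (simp del: of_nat_Suc)
    moreover have "real (Suc m) + \<alpha> + 1 = real m + (\<alpha> + 1) + 1" by simp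
    ultimately show "\<alpha> * a \<alpha> (Suc m) - a (\<alpha> - 1) (Suc m) = u * a (\<alpha> + 1) m"
      unfolding d[of "Suc m"] by (simp only: a_def mult_minus_left minus_minus mult.assoc)
  qed
  also have "suminf \<dots> = u * bessel_series (\<alpha> + 1) u"
    unfolding ser by (rule suminf_mult[OF s])
  finally show ?thesis by simp
qed

text \<open>An everywhere convergent power series is continuous, hence bounded on a compact
  interval. This covers small t, where the decay estimates below are silent.\<close>

lemma bessel_series_bounded_unit_interval:
  "\<exists>C\<ge>0. \<forall>u\<in>{0..1}. \<bar>bessel_series \<alpha> u\<bar> \<le> C"
proof -
  have cont: "continuous_on {0..1} (\<lambda>u. \<Sum>m. (rGamma (real m + \<alpha> + 1) / fact m) * (- u) ^ m)"
  proof (intro continuous_at_imp_continuous_on ballI)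
    fix u :: real
    have "summable (\<lambda>m. (rGamma (real m + \<alpha> + 1) / fact m) * (\<bar>u\<bar> + 1) ^ m)"
      using summable_bessel_series[of "- (\<bar>u\<bar> + 1)" \<alpha>] by (simp add: ac_simps)
    then have "isCont (\<lambda>v. \<Sum>m. (rGamma (real m + \<alpha> + 1) / fact m) * v ^ m) (- u)"
      by (rule isCont_powser) simp
    then show "isCont (\<lambda>u. \<Sum>m. (rGamma (real m + \<alpha> + 1) / fact m) * (- u) ^ m) u"
      by (rule isCont_o2[rotated]) simp
  qed
  have "bessel_series \<alpha> = (\<lambda>u. \<Sum>m. (rGamma (real m + \<alpha> + 1) / fact m) * (- u) ^ m)"
    by (simp add: bessel_series_def fun_eq_iff mult.commute)
  with cont have "continuous_on {0..1} (bessel_series \<alpha>)" by simp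
  then have "bounded (bessel_series \<alpha> ` {0..1})"
    using compact_continuous_image compact_imp_bounded by blast
  then obtain C where "\<forall>u\<in>{0..1}. \<bar>bessel_series \<alpha> u\<bar> \<le> C"
    by (auto simp: bounded_iff)
  then show ?thesis
    by (intro exI[of _ "max C 0"]) auto
qed

text \<open>These values turn the series of orders -1/2 and 1/2 into those of cosine and
  sine.\<close>

lemma rGamma_nat_plus_half:
  "rGamma (real m + 1/2) = 4 ^ m * fact m / (sqrt pi * fact (2 * m))"
proof (induction m)
  case 0
  show ?case by (simp add: rGamma_inverse_Gamma Gamma_one_half_real field_simps)
next
  case (Suc m)
  have "(real m + 1/2) * rGamma (real (Suc m) + 1/2) = rGamma (real m + 1/2)"
    using rGamma_plus1[of "real m + 1/2"] by (simp add: algebra_simps)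
  then have "rGamma (real (Suc m) + 1/2) = rGamma (real m + 1/2) / (real m + 1/2)"
    by (simp add: field_simps)
  also have "\<dots> = 4 ^ Suc m * fact (Suc m) / (sqrt pi * fact (2 * Suc m))"
    unfolding Suc.IH by (simp add: divide_simps) (simp add: algebra_simps)
  finally show ?case .
qed

text \<open>Equivalent to J_{-1/2}(t) = sqrt(2 / (\<pi> t)) cos t for t > 0; with the sine formula
  for order 1/2 it starts the recurrence.\<close>

lemma bessel_series_minus_half:
  "bessel_series (- 1/2) (t\<^sup>2 / 4) = cos t / sqrt pi"
proof -
  have "(\<lambda>m. (- (t\<^sup>2 / 4)) ^ m / fact m * rGamma (real m + - 1/2 + 1)) =
      (\<lambda>m. (- 1) ^ m / fact (2 * m) * t ^ (2 * m) / sqrt pi)"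
  proof
    fix m
    have "rGamma (real m + - 1/2 + 1) = 4 ^ m * fact m / (sqrt pi * fact (2 * m))"
      using rGamma_nat_plus_half[of m] by (simp add: add.commute)
    moreover have "(- (t\<^sup>2 / 4)) ^ m = (- 1) ^ m * t ^ (2 * m) / 4 ^ m"
      by (subst power_minus) (simp add: power_divide power_mult)
    ultimately show "(- (t\<^sup>2 / 4)) ^ m / fact m * rGamma (real m + - 1/2 + 1) =
        (- 1) ^ m / fact (2 * m) * t ^ (2 * m) / sqrt pi"
      by simp
  qed
  then show ?thesis
    unfolding bessel_series_def
    using sums_unique[OF sums_divide[OF cos_paired]] by metis
qed

lemma bessel_series_half:
  "t * bessel_series (1/2) (t\<^sup>2 / 4) = 2 * sin t / sqrt pi"
proof -
  have eq: "t * ((- (t\<^sup>2 / 4)) ^ m / fact m * rGamma (real m + 1/2 + 1)) =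
      2 / sqrt pi * ((- 1) ^ m / fact (2 * m + 1) * t ^ (2 * m + 1))" for m
  proof -
    have "(real m + 1/2) * rGamma (real m + 1/2 + 1) = 4 ^ m * fact m / (sqrt pi * fact (2 * m))"
      by (simp only: rGamma_plus1 rGamma_nat_plus_half)
    then have r: "rGamma (real m + 1/2 + 1) = 2 * (4 ^ m * fact m) / (sqrt pi * fact (2 * m + 1))"
      by (simp add: divide_simps) (simp add: algebra_simps)
    have p: "(- (t\<^sup>2 / 4)) ^ m = (- 1) ^ m * t ^ (2 * m) / 4 ^ m"
      by (subst power_minus) (simp add: power_divide power_mult)
    show ?thesis
      unfolding r p by (simp del: fact_Suc)
  qed
  have "t * bessel_series (1/2) (t\<^sup>2 / 4) =
      (\<Sum>m. t * ((- (t\<^sup>2 / 4)) ^ m / fact m * rGamma (real m + 1/2 + 1)))"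
    unfolding bessel_series_def by (rule suminf_mult[symmetric, OF summable_bessel_series])
  also have "\<dots> = 2 / sqrt pi * sin t"
    unfolding eq using sums_unique[OF sums_mult[OF sin_paired]] by metis
  finally show ?thesis by simp
qed

text \<open>The recurrence has three terms, so the induction carries two consecutive orders. The
  lower one is only claimed to be bounded, since order -1/2 is a cosine and does not decay; the
  higher one decays like 1 / t, as the sine formula shows for order 1/2.\<close>

lemma bessel_series_half_integer_decay:
  "(\<exists>C\<ge>0. \<forall>t\<ge>1. \<bar>bessel_series (real n - 1/2) (t\<^sup>2 / 4)\<bar> \<le> C) \<and>
   (\<exists>C\<ge>0. \<forall>t\<ge>1. t * \<bar>bessel_series (real n + 1/2) (t\<^sup>2 / 4)\<bar> \<le> C)"
proof (induction n)
  case 0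
  have "\<bar>bessel_series (- 1/2) (t\<^sup>2 / 4)\<bar> \<le> 1 / sqrt pi" for t
    unfolding bessel_series_minus_half by (simp add: divide_right_mono)
  moreover have "t * \<bar>bessel_series (1/2) (t\<^sup>2 / 4)\<bar> \<le> 2 / sqrt pi" if "t \<ge> 1" for t
  proof -
    have "t * \<bar>bessel_series (1/2) (t\<^sup>2 / 4)\<bar> = \<bar>t * bessel_series (1/2) (t\<^sup>2 / 4)\<bar>"
      using that by (simp add: abs_mult)
    also have "\<dots> \<le> 2 / sqrt pi"
      unfolding bessel_series_half by (simp add: abs_mult abs_divide divide_right_mono)
    finally show ?thesis .
  qed
  ultimately show ?case
    by (intro conjI exI[of _ "1 / sqrt pi"] exI[of _ "2 / sqrt pi"]) simp_all
next
  case (Suc n)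
  let ?\<phi> = "\<lambda>\<alpha> t. bessel_series \<alpha> (t\<^sup>2 / 4)"
  obtain C D where C: "C \<ge> 0" "\<And>t. t \<ge> 1 \<Longrightarrow> \<bar>?\<phi> (real n - 1/2) t\<bar> \<le> C"
    and D: "D \<ge> 0" "\<And>t. t \<ge> 1 \<Longrightarrow> t * \<bar>?\<phi> (real n + 1/2) t\<bar> \<le> D"
    using Suc.IH by blast
  \<comment> \<open>For t >= 1 decay implies boundedness, which is the claim on the lower order in
    the next pair.\<close>
  have D': "\<bar>?\<phi> (real n + 1/2) t\<bar> \<le> D" if "t \<ge> 1" for t
    using mult_right_mono[OF that, of "\<bar>?\<phi> (real n + 1/2) t\<bar>"] D(2)[OF that] by simp
  have "t * \<bar>?\<phi> (real (Suc n) + 1/2) t\<bar> \<le> 4 * ((real n + 1/2) * D + C)" if t: "t \<ge> 1" for t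
  proof -
    have "t\<^sup>2 / 4 * ?\<phi> (real n + 1/2 + 1) t =
        (real n + 1/2) * ?\<phi> (real n + 1/2) t - ?\<phi> (real n + 1/2 - 1) t"
      by (rule bessel_series_recurrence)
    then have rec: "t\<^sup>2 * ?\<phi> (real (Suc n) + 1/2) t =
        4 * ((real n + 1/2) * ?\<phi> (real n + 1/2) t - ?\<phi> (real n - 1/2) t)"
      by (simp add: add.commute add.left_commute)
    \<comment> \<open>The recurrence at u = t^2/4 even yields decay like 1 / t^2; one factor t is
      given away.\<close>
    have "t * 1 * \<bar>?\<phi> (real (Suc n) + 1/2) t\<bar> \<le> t * t * \<bar>?\<phi> (real (Suc n) + 1/2) t\<bar>"
      using t by (intro mult_right_mono mult_left_mono) auto
    also have "\<dots> = \<bar>4 * ((real n + 1/2) * ?\<phi> (real n + 1/2) t - ?\<phi> (real n - 1/2) t)\<bar>"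
      unfolding rec[symmetric] by (simp add: abs_mult power2_eq_square)
    also have "\<dots> \<le> 4 * ((real n + 1/2) * \<bar>?\<phi> (real n + 1/2) t\<bar> + \<bar>?\<phi> (real n - 1/2) t\<bar>)"
      using abs_triangle_ineq4[of "(real n + 1/2) * ?\<phi> (real n + 1/2) t" "?\<phi> (real n - 1/2) t"]
      by (simp add: abs_mult)
    also have "\<dots> \<le> 4 * ((real n + 1/2) * D + C)"
      using C(2)[OF t] D'[OF t] by (intro mult_left_mono add_mono) auto
    finally show ?thesis by simp
  qed
  moreover have "0 \<le> 4 * ((real n + 1/2) * D + C)"
    using C(1) D(1) by simp
  moreover have "real (Suc n) - 1/2 = real n + 1/2" by simp
  ultimately show ?case
    using D(1) D' by (intro conjI) (metis, blast)
qed

text \<open>The normalising power of t cancels the one in J_\<alpha>, leaving a power series in t^2.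
  At a pole \<open>Gamma\<close> has the value 0, so division by it agrees with
  \<open>rGamma\<close>.\<close>

lemma bessel_Jt_eq_series:
  assumes "t > 0"
  shows "bessel_Jt \<alpha> t = 2 powr (- \<alpha>) * bessel_series \<alpha> (t\<^sup>2 / 4)"
proof -
  have eq: "(- 1) ^ m / (fact m * Gamma (real m + \<alpha> + 1)) * (t / 2) powr (2 * real m + \<alpha>) =
      (t / 2) powr \<alpha> * ((- (t\<^sup>2 / 4)) ^ m / fact m * rGamma (real m + \<alpha> + 1))" for m
  proof -
    have "(t / 2) powr (2 * real m + \<alpha>) = (t / 2) ^ (2 * m) * (t / 2) powr \<alpha>"
      using assms powr_realpow[of "t / 2" "2 * m"] by (simp add: powr_add)
    moreover have "(- (t\<^sup>2 / 4)) ^ m = (- 1) ^ m * (t / 2) ^ (2 * m)"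
      by (subst power_minus) (simp add: power_divide power_mult)
    ultimately show ?thesis
      by (simp only: rGamma_inverse_Gamma divide_inverse inverse_mult_distrib mult_ac)
  qed
  have J: "bessel_J \<alpha> t = (t / 2) powr \<alpha> * bessel_series \<alpha> (t\<^sup>2 / 4)"
    unfolding bessel_J_def bessel_series_def eq
    by (rule suminf_mult[OF summable_bessel_series])
  have "t powr (- \<alpha>) * (t / 2) powr \<alpha> = 2 powr (- \<alpha>)"
    using assms by (simp add: powr_divide powr_minus inverse_eq_divide)
  then show ?thesis
    using assms unfolding bessel_Jt_def J by (simp flip: mult.assoc)
qed

text \<open>Bounding \<open>bessel_Jt\<close> at the single point \<open>0\<close> does not require evaluating the limit there.\<close>

lemma bessel_Jt_half_integer_bound:
  "\<exists>C\<ge>0. \<forall>t\<ge>0. (1 + t) * \<bar>bessel_Jt (real n + 1/2) t\<bar> \<le> C"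
proof -
  let ?\<alpha> = "real n + 1/2"
  obtain C where C: "C \<ge> 0" "\<And>t. t \<ge> 1 \<Longrightarrow> t * \<bar>bessel_series ?\<alpha> (t\<^sup>2 / 4)\<bar> \<le> C"
    using bessel_series_half_integer_decay[of n] by blast
  obtain D where D: "D \<ge> 0" "\<And>u. u \<in> {0..1} \<Longrightarrow> \<bar>bessel_series ?\<alpha> u\<bar> \<le> D"
    using bessel_series_bounded_unit_interval by blast
  define c where "c = 2 powr (- ?\<alpha>)"
  have c: "c > 0" by (simp add: c_def)
  have pos: "(1 + t) * \<bar>bessel_Jt ?\<alpha> t\<bar> \<le> c * (2 * C + 2 * D)" if "t > 0" for t
  proof -
    have "(1 + t) * \<bar>bessel_series ?\<alpha> (t\<^sup>2 / 4)\<bar> \<le> 2 * C + 2 * D"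
    \<comment> \<open>Above 1 the decay estimate applies with 1 + t <= 2 t; below 1 the argument
      t^2/4 lies in the unit interval and 1 + t <= 2.\<close>
    proof (cases "t \<ge> 1")
      case True
      have "(1 + t) * \<bar>bessel_series ?\<alpha> (t\<^sup>2 / 4)\<bar> \<le> 2 * t * \<bar>bessel_series ?\<alpha> (t\<^sup>2 / 4)\<bar>"
        using True by (intro mult_right_mono) auto
      with C(2)[OF True] D(1) show ?thesis by simp
    next
      case False
      with that have "t\<^sup>2 \<le> 1" by (simp add: power_le_one)
      then have "\<bar>bessel_series ?\<alpha> (t\<^sup>2 / 4)\<bar> \<le> D" by (intro D(2)) auto
      then have "(1 + t) * \<bar>bessel_series ?\<alpha> (t\<^sup>2 / 4)\<bar> \<le> 2 * D"
        using False that by (intro mult_mono) auto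
      with C(1) show ?thesis by simp
    qed
    then have "c * ((1 + t) * \<bar>bessel_series ?\<alpha> (t\<^sup>2 / 4)\<bar>) \<le> c * (2 * C + 2 * D)"
      using c by (intro mult_left_mono) auto
    moreover have "\<bar>bessel_Jt ?\<alpha> t\<bar> = c * \<bar>bessel_series ?\<alpha> (t\<^sup>2 / 4)\<bar>"
      using c unfolding bessel_Jt_eq_series[OF that] c_def[symmetric] by (simp add: abs_mult)
    ultimately show ?thesis by (simp only: mult.left_commute)
  qed
  show ?thesis
  proof (intro exI conjI allI impI)
    show "0 \<le> c * (2 * C + 2 * D) + \<bar>bessel_Jt ?\<alpha> 0\<bar>"
      using c C(1) D(1) by simp
    fix t :: real
    assume "0 \<le> t"
    then show "(1 + t) * \<bar>bessel_Jt ?\<alpha> t\<bar> \<le> c * (2 * C + 2 * D) + \<bar>bessel_Jt ?\<alpha> 0\<bar>"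
      using pos[of t] c C(1) D(1) by (cases "t = 0") auto
  qed
qed

section \<open>Growth of the kernel\<close>

text \<open>One constant is chosen per summand, before p is fixed; their sum is uniform in
  p.\<close>

lemma sum_bound_exists:
  fixes F :: "'i \<Rightarrow> 'p \<Rightarrow> real"
  assumes "finite S" and "\<And>l. l \<in> S \<Longrightarrow> \<exists>C\<ge>0. \<forall>p. P p \<longrightarrow> \<bar>F l p\<bar> \<le> C * G p"
  shows "\<exists>C\<ge>0. \<forall>p. P p \<longrightarrow> \<bar>\<Sum>l\<in>S. F l p\<bar> \<le> C * G p"
proof -
  obtain C where C: "\<And>l. l \<in> S \<Longrightarrow> C l \<ge> 0 \<and> (\<forall>p. P p \<longrightarrow> \<bar>F l p\<bar> \<le> C l * G p)"
    using assms(2) by metis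
  show ?thesis
  proof (intro exI conjI allI impI)
    show "0 \<le> sum C S" using C by (simp add: sum_nonneg)
    fix p assume "P p"
    have "\<bar>\<Sum>l\<in>S. F l p\<bar> \<le> (\<Sum>l\<in>S. \<bar>F l p\<bar>)" by (rule sum_abs)
    also have "\<dots> \<le> (\<Sum>l\<in>S. C l * G p)" using C \<open>P p\<close> by (intro sum_mono) blast
    finally show "\<bar>\<Sum>l\<in>S. F l p\<bar> \<le> sum C S * G p" by (simp add: sum_distrib_right)
  qed
qed

text \<open>The parameter R dominates both |s| and 1, so all powers of s with exponent up to
  \<open>lam\<close> share the bound R^lam. For the kernel R will be (1 + |x|) (1 + |y|).\<close>

lemma kernel_term_bound:
  assumes "k \<le> lam" and "\<alpha> = real n + 1/2"
  shows "\<exists>C\<ge>0. \<forall>s t R. \<bar>s\<bar> \<le> R \<longrightarrow> 1 \<le> R \<longrightarrow> 0 \<le> t \<longrightarrow>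
    \<bar>(1 + t) * (s ^ k * a * b * bessel_Jt \<alpha> t)\<bar> \<le> C * R ^ lam"
proof -
  obtain C where C: "C \<ge> 0" "\<And>t. t \<ge> 0 \<Longrightarrow> (1 + t) * \<bar>bessel_Jt \<alpha> t\<bar> \<le> C"
    using bessel_Jt_half_integer_bound[of n] assms(2) by blast
  show ?thesis
  proof (intro exI conjI allI impI)
    show "0 \<le> \<bar>a * b\<bar> * C" using C(1) by simp
    fix s t R :: real
    assume s: "\<bar>s\<bar> \<le> R" and R: "1 \<le> R" and t: "0 \<le> t"
    have "\<bar>s\<bar> ^ k \<le> R ^ k" using s by (intro power_mono) auto
    also have "\<dots> \<le> R ^ lam" using R assms(1) by (rule power_increasing[rotated])
    finally have "\<bar>s\<bar> ^ k * ((1 + t) * \<bar>bessel_Jt \<alpha> t\<bar>) \<le> R ^ lam * C"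
      using C t R by (intro mult_mono) auto
    from mult_left_mono[OF this, of "\<bar>a * b\<bar>"]
    show "\<bar>(1 + t) * (s ^ k * a * b * bessel_Jt \<alpha> t)\<bar> \<le> \<bar>a * b\<bar> * C * R ^ lam"
      using t by (simp add: abs_mult power_abs ac_simps)
  qed
qed

lemma kernel_sum_bound:
  assumes "finite S" and "\<And>l. l \<in> S \<Longrightarrow> k l \<le> lam"
    and "\<And>l. l \<in> S \<Longrightarrow> \<exists>n. \<alpha> l = real n + 1/2"
  shows "\<exists>C\<ge>0. \<forall>s t R. \<bar>s\<bar> \<le> R \<longrightarrow> 1 \<le> R \<longrightarrow> 0 \<le> t \<longrightarrow>
    (1 + t) * \<bar>\<Sum>l\<in>S. s ^ k l * a l * b l * bessel_Jt (\<alpha> l) t\<bar> \<le> C * R ^ lam"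
proof -
  \<comment> \<open>The triple (s, t, R) becomes a single parameter, to match
    \<open>sum_bound_exists\<close>.\<close>
  have "\<exists>C\<ge>0. \<forall>p. (case p of (s, t, R) \<Rightarrow> \<bar>s\<bar> \<le> R \<and> 1 \<le> R \<and> 0 \<le> t) \<longrightarrow>
      \<bar>\<Sum>l\<in>S. case p of (s, t, R) \<Rightarrow> (1 + t) * (s ^ k l * a l * b l * bessel_Jt (\<alpha> l) t)\<bar>
        \<le> C * (case p of (s, t, R) \<Rightarrow> R ^ lam)"
  proof (rule sum_bound_exists[OF assms(1)])
    fix l assume l: "l \<in> S"
    obtain n where "\<alpha> l = real n + 1/2" using assms(3)[OF l] by blast
    from kernel_term_bound[OF assms(2)[OF l] this, of "a l" "b l"]
    show "\<exists>C\<ge>0. \<forall>p. (case p of (s, t, R) \<Rightarrow> \<bar>s\<bar> \<le> R \<and> 1 \<le> R \<and> 0 \<le> t) \<longrightarrow>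
      \<bar>case p of (s, t, R) \<Rightarrow> (1 + t) * (s ^ k l * a l * b l * bessel_Jt (\<alpha> l) t)\<bar>
        \<le> C * (case p of (s, t, R) \<Rightarrow> R ^ lam)"
      by auto
  qed
  then obtain C where C: "C \<ge> 0" "\<And>s t R. \<bar>s\<bar> \<le> R \<Longrightarrow> 1 \<le> R \<Longrightarrow> 0 \<le> t \<Longrightarrow>
      \<bar>\<Sum>l\<in>S. (1 + t) * (s ^ k l * a l * b l * bessel_Jt (\<alpha> l) t)\<bar> \<le> C * R ^ lam"
    by auto
  show ?thesis
  proof (intro exI conjI allI impI)
    show "0 \<le> C" by (rule C(1))
    fix s t R :: real
    assume *: "\<bar>s\<bar> \<le> R" "1 \<le> R" "0 \<le> t"
    have "(1 + t) * \<bar>\<Sum>l\<in>S. s ^ k l * a l * b l * bessel_Jt (\<alpha> l) t\<bar> =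
        \<bar>\<Sum>l\<in>S. (1 + t) * (s ^ k l * a l * b l * bessel_Jt (\<alpha> l) t)\<bar>"
      using * by (simp add: abs_mult flip: sum_distrib_left)
    with C(2)[OF *]
    show "(1 + t) * \<bar>\<Sum>l\<in>S. s ^ k l * a l * b l * bessel_Jt (\<alpha> l) t\<bar> \<le> C * R ^ lam"
      by simp
  qed
qed

text \<open>The Bessel orders are lam - l - 1/2 and lam - l + 1/2. They have the form n + 1/2 with n
  a natural number because l <= lam/2 < lam; this keeps out the order -1/2, which has no
  decay.\<close>

lemma kernel_parts_bound:
  assumes lam: "lam \<ge> 1"
  shows "\<exists>C\<ge>0. \<forall>s t R. \<bar>s\<bar> \<le> R \<longrightarrow> 1 \<le> R \<longrightarrow> 0 \<le> t \<longrightarrow>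
    (1 + t) * \<bar>A_star lam s t\<bar> \<le> C * R ^ lam \<and>
    (1 + t) * \<bar>B_star lam s t\<bar> \<le> C * R ^ lam \<and>
    (1 + t) * \<bar>C_star lam s t\<bar> \<le> C * R ^ lam"
proof -
  have less: "l < lam" if "l \<in> {0..nat \<lfloor>real lam / 2\<rfloor>}" for l
    using that lam by simp linarith
  \<comment> \<open>The upper limit here is the floor of lam/2 - 1/4, so the range lies within that
    of the other two sums.\<close>
  have less': "l < lam" if "l \<in> {0..nat \<lfloor>(real lam + 1) / 2 - 3 / 4\<rfloor>}" for l
  proof (rule less)
    have "\<lfloor>(real lam + 1) / 2 - 3 / 4\<rfloor> \<le> \<lfloor>real lam / 2\<rfloor>"
      by (rule floor_mono) (simp add: field_simps)
    with that show "l \<in> {0..nat \<lfloor>real lam / 2\<rfloor>}" by simp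
  qed
  have half1: "\<exists>n. (2 * real lam - 2 * real l - 1) / 2 = real n + 1/2" if "l < lam" for l
    using that by (intro exI[of _ "lam - l - 1"]) (simp add: of_nat_diff field_simps)
  have half2: "\<exists>n. (2 * real lam - 2 * real l + 1) / 2 = real n + 1/2" if "l < lam" for l
    using that by (intro exI[of _ "lam - l"]) (simp add: of_nat_diff field_simps)
  have "\<exists>C\<ge>0. \<forall>s t R. \<bar>s\<bar> \<le> R \<longrightarrow> 1 \<le> R \<longrightarrow> 0 \<le> t \<longrightarrow> (1 + t) * \<bar>A_star lam s t\<bar> \<le> C * R ^ lam"
    unfolding A_star_def by (rule kernel_sum_bound, simp, simp, rule half1, rule less')
  then obtain A where A: "A \<ge> 0" "\<And>s t R. \<bar>s\<bar> \<le> R \<Longrightarrow> 1 \<le> R \<Longrightarrow> 0 \<le> t \<Longrightarrow> (1 + t) * \<bar>A_star lam s t\<bar> \<le> A * R ^ lam"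
    by blast
  have "\<exists>C\<ge>0. \<forall>s t R. \<bar>s\<bar> \<le> R \<longrightarrow> 1 \<le> R \<longrightarrow> 0 \<le> t \<longrightarrow> (1 + t) * \<bar>B_star lam s t\<bar> \<le> C * R ^ lam"
    unfolding B_star_def abs_minus_cancel by (rule kernel_sum_bound, simp, simp, rule half1, rule less)
  then obtain B where B: "B \<ge> 0" "\<And>s t R. \<bar>s\<bar> \<le> R \<Longrightarrow> 1 \<le> R \<Longrightarrow> 0 \<le> t \<Longrightarrow> (1 + t) * \<bar>B_star lam s t\<bar> \<le> B * R ^ lam"
    by blast
  have "\<exists>C\<ge>0. \<forall>s t R. \<bar>s\<bar> \<le> R \<longrightarrow> 1 \<le> R \<longrightarrow> 0 \<le> t \<longrightarrow> (1 + t) * \<bar>C_star lam s t\<bar> \<le> C * R ^ lam"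
    unfolding C_star_def abs_minus_cancel by (rule kernel_sum_bound, simp, simp, rule half2, rule less)
  then obtain C where C: "C \<ge> 0" "\<And>s t R. \<bar>s\<bar> \<le> R \<Longrightarrow> 1 \<le> R \<Longrightarrow> 0 \<le> t \<Longrightarrow> (1 + t) * \<bar>C_star lam s t\<bar> \<le> C * R ^ lam"
    by blast
  have mono: "c * R ^ lam \<le> (A + B + C) * R ^ lam" if "c \<le> A + B + C" "1 \<le> R" for c R :: real
    using that by (intro mult_right_mono) auto
  show ?thesis
  proof (intro exI conjI allI impI)
    show "0 \<le> A + B + C" using A(1) B(1) C(1) by simp
    fix s t R :: real
    assume *: "\<bar>s\<bar> \<le> R" "1 \<le> R" "0 \<le> t"
    show "(1 + t) * \<bar>A_star lam s t\<bar> \<le> (A + B + C) * R ^ lam"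
      using A(2)[OF *] mono[of A R] *(2) B(1) C(1) by linarith
    show "(1 + t) * \<bar>B_star lam s t\<bar> \<le> (A + B + C) * R ^ lam"
      using B(2)[OF *] mono[of B R] *(2) A(1) C(1) by linarith
    show "(1 + t) * \<bar>C_star lam s t\<bar> \<le> (A + B + C) * R ^ lam"
      using C(2)[OF *] mono[of C R] *(2) A(1) B(1) by linarith
  qed
qed

section \<open>Norm estimates for the wedge product, the Clifford product and the kernel\<close>

text \<open>Expanding the square gives three double sums that factorise. Summation over ordered
  pairs counts each pair j < k twice, whence the factor 2.\<close>

lemma lagrange_identity:
  fixes x y :: "real ^ 'n"
  shows "(\<Sum>j\<in>UNIV. \<Sum>k\<in>UNIV. (x $ j * y $ k - x $ k * y $ j)\<^sup>2) =
    2 * ((norm x)\<^sup>2 * (norm y)\<^sup>2 - (x \<bullet> y)\<^sup>2)"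
proof -
  have "(\<Sum>j\<in>UNIV. \<Sum>k\<in>UNIV. (x $ j * y $ k - x $ k * y $ j)\<^sup>2) =
      (\<Sum>j\<in>UNIV. \<Sum>k\<in>UNIV. (x $ j * x $ j) * (y $ k * y $ k)) +
      (\<Sum>j\<in>UNIV. \<Sum>k\<in>UNIV. (y $ j * y $ j) * (x $ k * x $ k)) -
      2 * (\<Sum>j\<in>UNIV. \<Sum>k\<in>UNIV. (x $ j * y $ j) * (x $ k * y $ k))"
    unfolding sum_distrib_left sum.distrib[symmetric] sum_subtractf[symmetric]
    by (intro sum.cong refl) (simp add: power2_eq_square algebra_simps)
  also have "\<dots> = 2 * ((x \<bullet> x) * (y \<bullet> y) - (x \<bullet> y)\<^sup>2)"
    unfolding sum_product[symmetric] inner_vec_def inner_real_def power2_eq_square by simp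
  finally show ?thesis by (simp add: power2_norm_eq_inner)
qed

lemma norm_cbasis [simp]: "norm (cbasis A) = 1"
  by (simp add: cbasis_def norm_eq_1 inner_axis_axis)

text \<open>Each coefficient is a single term of Lagrange's sum, hence at most sqrt 2 times the
  root; products of two generators have norm 1, and the pairs j < k are counted crudely by all
  pairs.\<close>

lemma norm_wedge_le:
  fixes x y :: "real ^ 'n::{finite,linorder}"
  shows "norm (wedge x y) \<le> 2 * real CARD('n \<times> 'n) * sqrt ((norm x)\<^sup>2 * (norm y)\<^sup>2 - (x \<bullet> y)\<^sup>2)"
    (is "_ \<le> _ * ?t")
proof -
  define q where "q j k = x $ j * y $ k - x $ k * y $ j" for j k
  have q: "\<bar>q j k\<bar> \<le> 2 * ?t" for j k
  proof -
    have "(q j k)\<^sup>2 \<le> (\<Sum>k\<in>UNIV. (q j k)\<^sup>2)" by (rule member_le_sum) auto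
    also have "\<dots> \<le> (\<Sum>j\<in>UNIV. \<Sum>k\<in>UNIV. (q j k)\<^sup>2)"
      by (rule member_le_sum[where f = "\<lambda>j. \<Sum>k\<in>UNIV. (q j k)\<^sup>2"]) (auto intro: sum_nonneg)
    also have "\<dots> = 2 * ((norm x)\<^sup>2 * (norm y)\<^sup>2 - (x \<bullet> y)\<^sup>2)"
      unfolding q_def by (rule lagrange_identity)
    finally have *: "(q j k)\<^sup>2 \<le> 2 * ((norm x)\<^sup>2 * (norm y)\<^sup>2 - (x \<bullet> y)\<^sup>2)" .
    then have "\<bar>q j k\<bar> \<le> sqrt (2 * ((norm x)\<^sup>2 * (norm y)\<^sup>2 - (x \<bullet> y)\<^sup>2))"
      using real_sqrt_le_mono by fastforce
    \<comment> \<open>The factor sqrt 2 is rounded up to 2; the radicand is nonnegative because it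
      dominates a square by \<open>*\<close>.\<close>
    also have "\<dots> \<le> sqrt (2\<^sup>2 * ((norm x)\<^sup>2 * (norm y)\<^sup>2 - (x \<bullet> y)\<^sup>2))"
      using order_trans[OF zero_le_power2 *] by (intro real_sqrt_le_mono mult_right_mono) auto
    finally show ?thesis unfolding real_sqrt_mult by simp
  qed
  have sgn: "norm (cgen j \<star> cgen k) = 1" for j k :: 'n
    by (simp add: cmul_cbasis clifford_sign_def)
  have "norm (wedge x y) \<le> (\<Sum>p\<in>{(j, k :: 'n). j < k}. 2 * ?t)"
    unfolding wedge_def q_def[symmetric]
    by (rule sum_norm_le) (use q in \<open>auto simp: sgn\<close>)
  also have "\<dots> \<le> (\<Sum>p\<in>(UNIV :: ('n \<times> 'n) set). 2 * ?t)"
    by (rule sum_mono2) (use order_trans[OF abs_ge_zero q] in auto)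
  finally show ?thesis by (simp add: ac_simps)
qed

text \<open>A crude count: every coefficient is at most the norm, every sign has modulus 1, and each
  pair of basis elements contributes one summand.\<close>

lemma norm_cmul_le:
  fixes a b :: "'n::{finite,linorder} clifford"
  shows "norm (a \<star> b) \<le> real CARD('n set \<times> 'n set) * (norm a * norm b)"
proof -
  have "norm (a \<star> b) \<le> (\<Sum>A\<in>(UNIV :: 'n set set). \<Sum>B\<in>(UNIV :: 'n set set). norm a * norm b)"
    unfolding cmul_def
  proof (intro order_trans[OF norm_sum] sum_mono)
    fix A B :: "'n set"
    have "\<bar>clifford_sign A B\<bar> = 1" by (simp add: clifford_sign_def power_abs)
    then show "norm ((a $ A * b $ B * clifford_sign A B) *\<^sub>R cbasis (sym_diff A B)) \<le> norm a * norm b"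
      by (simp add: abs_mult mult_mono component_le_norm_cart)
  qed
  then show ?thesis by simp
qed

lemma cf_kernel_bound:
  assumes "cf_lambda TYPE('n::{finite,linorder}) \<ge> 1"
  shows "\<exists>C\<ge>0. \<forall>x y :: real ^ ('n::{finite,linorder}).
    norm (cf_kernel x y) \<le> C * ((1 + norm x) * (1 + norm y)) ^ cf_lambda TYPE('n)"
proof -
  define lam where "lam = cf_lambda TYPE('n)"
  define N where "N = 2 * real CARD('n \<times> 'n)"
  have N: "N \<ge> 0" by (simp add: N_def)
  obtain C where C: "C \<ge> 0" "\<And>s t R. \<bar>s\<bar> \<le> R \<Longrightarrow> 1 \<le> R \<Longrightarrow> 0 \<le> t \<Longrightarrow>
    (1 + t) * \<bar>A_star lam s t\<bar> \<le> C * R ^ lam \<and>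
    (1 + t) * \<bar>B_star lam s t\<bar> \<le> C * R ^ lam \<and>
    (1 + t) * \<bar>C_star lam s t\<bar> \<le> C * R ^ lam"
    using kernel_parts_bound[OF assms] unfolding lam_def by blast
  have "norm (cf_kernel x y) \<le> sqrt (pi / 2) * (2 + N) * C * ((1 + norm x) * (1 + norm y)) ^ lam"
    for x y :: "real ^ ('n::{finite,linorder})"
  proof -
    define s where "s = x \<bullet> y"
    define t where "t = sqrt ((norm x)\<^sup>2 * (norm y)\<^sup>2 - s\<^sup>2)"
    define R where "R = (1 + norm x) * (1 + norm y)"
    have "s\<^sup>2 \<le> (norm x * norm y)\<^sup>2"
      unfolding s_def by (rule power2_le_iff_abs_le[THEN iffD2]) (auto intro: Cauchy_Schwarz_ineq2)
    then have t: "t \<ge> 0" by (simp add: t_def power_mult_distrib)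
    have R: "1 \<le> R" "norm x * norm y \<le> R"
      unfolding R_def by (simp_all add: algebra_simps add_increasing2)
    have s: "\<bar>s\<bar> \<le> R"
      using Cauchy_Schwarz_ineq2[of x y] R(2) by (simp add: s_def)
    note bound = C(2)[OF s R(1) t]
    \<comment> \<open>The first form serves the two scalar parts. The second serves the wedge part,
      where the factor t from \<open>norm_wedge_le\<close> uses up the decay of
      \<open>C_star\<close>.\<close>
    have le: "\<bar>z\<bar> \<le> (1 + t) * \<bar>z\<bar>" "t * \<bar>z\<bar> \<le> (1 + t) * \<bar>z\<bar>" for z
      using t by (simp_all add: algebra_simps)
    have "\<bar>C_star lam s t\<bar> * norm (wedge x y) \<le> \<bar>C_star lam s t\<bar> * (N * t)"
      using norm_wedge_le[of x y] by (intro mult_left_mono) (simp_all add: N_def t_def s_def)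
    also have "\<dots> = N * (t * \<bar>C_star lam s t\<bar>)" by simp
    also have "\<dots> \<le> N * (C * R ^ lam)"
      using bound le(2)[of "C_star lam s t"] N by (intro mult_left_mono) linarith+
    finally have w: "\<bar>C_star lam s t\<bar> * norm (wedge x y) \<le> N * (C * R ^ lam)" .
    have "norm (cscalar (A_star lam s t + B_star lam s t) + C_star lam s t *\<^sub>R wedge x y)
        \<le> \<bar>A_star lam s t + B_star lam s t\<bar> + \<bar>C_star lam s t\<bar> * norm (wedge x y)"
      by (rule norm_triangle_le) simp
    also have "\<dots> \<le> 2 * (C * R ^ lam) + N * (C * R ^ lam)"
      using bound w le(1)[of "A_star lam s t"] le(1)[of "B_star lam s t"] by linarith
    finally have "sqrt (pi / 2) * norm (cscalar (A_star lam s t + B_star lam s t) + C_star lam s t *\<^sub>R wedge x y)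
        \<le> sqrt (pi / 2) * ((2 + N) * (C * R ^ lam))"
      by (intro mult_left_mono) (simp_all add: algebra_simps)
    moreover have "norm (cf_kernel x y) = sqrt (pi / 2) *
        norm (cscalar (A_star lam s t + B_star lam s t) + C_star lam s t *\<^sub>R wedge x y)"
      unfolding cf_kernel_def Let_def lam_def[symmetric] s_def[symmetric] t_def[symmetric]
      by (simp add: abs_mult power_abs)
    ultimately show ?thesis by (simp add: R_def mult.assoc)
  qed
  then show ?thesis
    using C(1) N unfolding lam_def[symmetric]
    by (intro exI[of _ "sqrt (pi / 2) * (2 + N) * C"]) simp
qed

section \<open>Growth of the short-time transform\<close>

text \<open>Translation invariance, as the affine change of variables whose scale factors are all 1,
  so that the density is 1.\<close>

lemma
  fixes h :: "'a::euclidean_space \<Rightarrow> real"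
  assumes "integrable lebesgue h"
  shows integrable_lebesgue_shift: "integrable lebesgue (\<lambda>t. h (t - x))"
    and integral_lebesgue_shift: "(LINT t|lebesgue. h (t - x)) = (LINT t|lebesgue. h t)"
proof -
  have T: "(- x + (\<Sum>j\<in>Basis. (1 * (t \<bullet> j)) *\<^sub>R j)) = t - x" for t :: 'a
    by (simp add: euclidean_representation)
  have eq: "lebesgue = distr lebesgue lebesgue (\<lambda>t :: 'a. t - x)"
    using lebesgue_affine_euclidean[of "\<lambda>_ :: 'a. 1" "- x"] unfolding T by (simp add: density_1)
  have [measurable]: "(\<lambda>t. t - x) \<in> lebesgue \<rightarrow>\<^sub>M lebesgue"
    using lebesgue_affine_measurable[of "\<lambda>_ :: 'a. 1" "- x"] unfolding T by simp
  have [measurable]: "h \<in> borel_measurable lebesgue"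
    using assms by (rule borel_measurable_integrable)
  show "integrable lebesgue (\<lambda>t. h (t - x))"
    using assms by (subst (asm) eq) (simp add: integrable_distr_eq)
  show "(LINT t|lebesgue. h (t - x)) = (LINT t|lebesgue. h t)"
    by (subst (2) eq) (simp add: integral_distr)
qed

text \<open>The integrand is dominated pointwise by means of a b <= (a^2 + b^2) / 2, with a the
  weighted translated window and b = |f|. Both squares integrate to 1 by the normalisation, so this
  gives what the Cauchy-Schwarz inequality would give.\<close>

lemma norm_cstft_bound:
  assumes lam: "cf_lambda TYPE('n::{finite,linorder}) \<ge> 1"
  shows "\<exists>C>0. \<forall>(f :: real ^ ('n::{finite,linorder}) \<Rightarrow> 'n clifford) (g :: real ^ ('n::{finite,linorder}) \<Rightarrow> real) x \<omega>.
    f \<in> L2 \<longrightarrow> g \<in> W_space (2 * real (cf_lambda TYPE('n))) \<longrightarrow>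
    L2_norm f = 1 \<longrightarrow> W_norm (2 * real (cf_lambda TYPE('n))) g = 1 \<longrightarrow>
    norm (cstft g f x \<omega>) \<le> C * ((1 + norm x) * (1 + norm \<omega>)) ^ cf_lambda TYPE('n)"
proof -
  define lam where "lam = cf_lambda TYPE('n)"
  define M where "M = real CARD('n set \<times> 'n set)"
  have M: "M \<ge> 0" by (simp add: M_def)
  define p where "p = (2 * pi) powr (- (real CARD('n) / 2))"
  have p: "p > 0" by (simp add: p_def)
  obtain C where C: "C \<ge> 0"
    "\<And>x y :: real ^ ('n::{finite,linorder}). norm (cf_kernel x y) \<le> C * ((1 + norm x) * (1 + norm y)) ^ lam"
    using cf_kernel_bound[OF lam] unfolding lam_def by blast
  have "norm (cstft g f x \<omega>) \<le> p * (M * C + 1) * ((1 + norm x) * (1 + norm \<omega>)) ^ lam"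
    if f: "f \<in> L2" "L2_norm f = 1"
      and g: "g \<in> W_space (2 * real lam)" "W_norm (2 * real lam) g = 1"
    for f :: "real ^ ('n::{finite,linorder}) \<Rightarrow> 'n clifford" and g :: "real ^ ('n::{finite,linorder}) \<Rightarrow> real" and x \<omega>
  proof -
    define Q where "Q = ((1 + norm x) * (1 + norm \<omega>)) ^ lam"
    have Q: "Q \<ge> 0" by (simp add: Q_def)
    define h where "h t = (1 + norm t) powr (2 * real lam) * \<bar>g t\<bar>\<^sup>2" for t
    have h: "integrable lebesgue h" "(LINT t|lebesgue. h t) = 1"
      using g by (simp_all add: h_def[abs_def] W_space_def W_norm_def)
    have h_eq: "h t = ((1 + norm t) ^ lam * \<bar>g t\<bar>)\<^sup>2" for t
    proof -
      have "1 + norm t > 0" by (simp add: add_pos_nonneg)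
      then have "(1 + norm t) powr (2 * real lam) = ((1 + norm t) ^ lam)\<^sup>2"
        using powr_realpow[of "1 + norm t" "lam * 2"] by (simp add: power_mult mult.commute)
      then show ?thesis by (simp add: h_def power_mult_distrib)
    qed
    have ff: "integrable lebesgue (\<lambda>t. (norm (f t))\<^sup>2)" "(LINT t|lebesgue. (norm (f t))\<^sup>2) = 1"
      using f by (simp_all add: L2_def L2_norm_def)
    note hs = integrable_lebesgue_shift[OF h(1), of x]
    let ?F = "\<lambda>t. cf_kernel t \<omega> \<star> (g (t - x) *\<^sub>R f t)"
    let ?D = "\<lambda>t. M * C * Q * ((h (t - x) + (norm (f t))\<^sup>2) / 2)"
    have D: "integrable lebesgue ?D" "(LINT t|lebesgue. ?D t) = M * C * Q"
      using hs ff h integral_lebesgue_shift[OF h(1), of x] by simp_all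
    have dom: "norm (?F t) \<le> ?D t" for t
    proof -
      \<comment> \<open>By \<open>h_eq\<close>, a^2 is the translated weighted square of the window,
        so a^2 + b^2 is the bracket in \<open>?D\<close>.\<close>
      define a b where "a = (1 + norm (t - x)) ^ lam * \<bar>g (t - x)\<bar>" and "b = norm (f t)"
      have "norm t \<le> norm x + norm (t - x)"
        using norm_triangle_ineq[of x "t - x"] by simp
      moreover have "0 \<le> norm x * norm (t - x)" by (rule mult_nonneg_nonneg) simp_all
      ultimately have "1 + norm t \<le> (1 + norm x) * (1 + norm (t - x))"
        unfolding distrib_left distrib_right by linarith
      then have "((1 + norm t) * (1 + norm \<omega>)) ^ lam
          \<le> ((1 + norm x) * (1 + norm (t - x)) * (1 + norm \<omega>)) ^ lam"
        by (intro power_mono mult_right_mono) auto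
      also have "\<dots> = Q * (1 + norm (t - x)) ^ lam"
        by (simp add: Q_def power_mult_distrib)
      finally have K: "norm (cf_kernel t \<omega>) \<le> C * (Q * (1 + norm (t - x)) ^ lam)"
        using C(1) by (intro order_trans[OF C(2)] mult_left_mono)
      have "norm (?F t) \<le> M * (norm (cf_kernel t \<omega>) * norm (g (t - x) *\<^sub>R f t))"
        unfolding M_def by (rule norm_cmul_le)
      also have "\<dots> \<le> M * (C * (Q * (1 + norm (t - x)) ^ lam) * norm (g (t - x) *\<^sub>R f t))"
        using K M by (intro mult_left_mono mult_right_mono) auto
      also have "\<dots> = M * C * Q * (a * b)"
        by (simp add: a_def b_def)
      also have "\<dots> \<le> M * C * Q * ((a\<^sup>2 + b\<^sup>2) / 2)"
        using M C(1) Q sum_squares_bound[of a b] by (intro mult_left_mono) simp_all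
      finally show ?thesis by (simp add: a_def b_def h_eq)
    qed
    have "norm (LINT t|lebesgue. ?F t) \<le> M * C * Q"
    \<comment> \<open>If the integrand is not integrable, the integral is 0 by convention and the
      bound is trivial.\<close>
    proof (cases "integrable lebesgue ?F")
      case True
      have "norm (LINT t|lebesgue. ?F t) \<le> (LINT t|lebesgue. norm (?F t))"
        by (rule integral_norm_bound)
      also have "\<dots> \<le> (LINT t|lebesgue. ?D t)"
        using True D(1) dom by (intro integral_mono) auto
      finally show ?thesis unfolding D(2) .
    next
      case False
      then show ?thesis using M C(1) Q by (simp add: not_integrable_integral_eq)
    qed
    \<comment> \<open>Adding 1 makes the constant strictly positive, as C may be 0.\<close>
    also have "\<dots> \<le> (M * C + 1) * Q"
      using Q by (simp add: algebra_simps)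
    finally show ?thesis
      unfolding cstft_def p_def[symmetric] using p by (simp add: Q_def mult.assoc)
  qed
  moreover have "p * (M * C + 1) > 0"
    using p M C(1) by (simp add: add_nonneg_pos)
  ultimately show ?thesis
    unfolding lam_def[symmetric] by blast
qed

section \<open>From the pointwise growth bound to the measure of U\<close>

theorem proposition9p2:
  assumes "CARD('n::{finite,linorder}) > 2" and "even CARD('n)"
  shows "\<exists>c::real. c > 0 \<and>
    (\<forall>(f :: real ^ ('n::{finite,linorder}) \<Rightarrow> 'n clifford) (g :: real ^ ('n::{finite,linorder}) \<Rightarrow> real)
       (U :: ((real ^ ('n::{finite,linorder})) \<times> (real ^ ('n::{finite,linorder}))) set) (\<epsilon> :: real).
      f \<in> L2 \<longrightarrow> g \<in> W_space (2 * real (cf_lambda TYPE('n))) \<longrightarrow> radial g \<longrightarrow>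
      L2_norm f = 1 \<longrightarrow> W_norm (2 * real (cf_lambda TYPE('n))) g = 1 \<longrightarrow>
      open U \<longrightarrow> \<epsilon> \<ge> 0 \<longrightarrow>
      (\<integral>\<^sup>+(x, \<omega>)\<in>U. ennreal
          ((1 + norm x) powr (- 2 * real (cf_lambda TYPE('n)))
           * (1 + norm \<omega>) powr (- 2 * real (cf_lambda TYPE('n)))
           * (norm (cstft g f x \<omega>))\<^sup>2) \<partial>lebesgue) \<ge> ennreal (1 - \<epsilon>) \<longrightarrow>
      emeasure lebesgue U \<ge> ennreal ((1 - \<epsilon>) * (1 / c)))"
proof -
  define lam where "lam = cf_lambda TYPE('n)"
  \<comment> \<open>An even dimension above 2 is at least 4.\<close>
  have lam: "lam \<ge> 1"
    using assms unfolding lam_def cf_lambda_def by presburger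
  obtain C where C: "C > 0" "\<And>(f :: real ^ ('n::{finite,linorder}) \<Rightarrow> 'n clifford) (g :: real ^ ('n::{finite,linorder}) \<Rightarrow> real) x \<omega>.
      f \<in> L2 \<Longrightarrow> g \<in> W_space (2 * real lam) \<Longrightarrow> L2_norm f = 1 \<Longrightarrow> W_norm (2 * real lam) g = 1 \<Longrightarrow>
      norm (cstft g f x \<omega>) \<le> C * ((1 + norm x) * (1 + norm \<omega>)) ^ lam"
    using norm_cstft_bound lam unfolding lam_def by metis
  show ?thesis
    unfolding lam_def[symmetric]
  \<comment> \<open>The constant c is the square of the growth constant, since the transform enters
    the integral squared.\<close>
  proof (intro exI[of _ "C\<^sup>2"] conjI allI impI)
    show "C\<^sup>2 > 0" using C(1) by simp
    fix f :: "real ^ ('n::{finite,linorder}) \<Rightarrow> 'n clifford" and g :: "real ^ ('n::{finite,linorder}) \<Rightarrow> real"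
      and U :: "((real ^ ('n::{finite,linorder})) \<times> (real ^ ('n::{finite,linorder}))) set" and \<epsilon> :: real
    assume f: "f \<in> L2" "L2_norm f = 1"
      and g: "g \<in> W_space (2 * real lam)" "W_norm (2 * real lam) g = 1"
      and U: "open U"
      and lower: "ennreal (1 - \<epsilon>) \<le> (\<integral>\<^sup>+(x, \<omega>)\<in>U. ennreal
          ((1 + norm x) powr (- 2 * real lam) * (1 + norm \<omega>) powr (- 2 * real lam)
           * (norm (cstft g f x \<omega>))\<^sup>2) \<partial>lebesgue)"
    \<comment> \<open>The two weights multiply to the inverse square of the growth factor P, so only
      the constant survives.\<close>
    have weight: "(1 + norm x) powr (- 2 * real lam) * (1 + norm \<omega>) powr (- 2 * real lam)
        * (norm (cstft g f x \<omega>))\<^sup>2 \<le> C\<^sup>2" for x \<omega>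
    proof -
      define P where "P = ((1 + norm x) * (1 + norm \<omega>)) ^ lam"
      have P: "P > 0" by (simp add: P_def add_pos_nonneg)
      have "(1 + norm z) powr (- 2 * real lam) = inverse (((1 + norm z) ^ lam)\<^sup>2)" for z :: "real ^ ('n::{finite,linorder})"
      proof -
        have "1 + norm z > 0" by (simp add: add_pos_nonneg)
        then show ?thesis
          using powr_realpow[of "1 + norm z" "lam * 2"]
          by (simp add: powr_minus power_mult mult.commute)
      qed
      then have "(1 + norm x) powr (- 2 * real lam) * (1 + norm \<omega>) powr (- 2 * real lam) = inverse (P\<^sup>2)"
        by (simp add: P_def power_mult_distrib)
      moreover have "(norm (cstft g f x \<omega>))\<^sup>2 \<le> (C * P)\<^sup>2"
        unfolding P_def using C(2)[OF f(1) g(1) f(2) g(2)] by (intro power_mono) auto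
      ultimately show ?thesis
        using P by (simp only:) (simp add: field_simps)
    qed
    have "ennreal (1 - \<epsilon>) \<le> (\<integral>\<^sup>+p. ennreal (C\<^sup>2) * indicator U p \<partial>lebesgue)"
      using weight
      by (intro order_trans[OF lower] nn_integral_mono)
        (auto simp: case_prod_beta intro!: mult_right_mono ennreal_leI)
    also have "\<dots> = ennreal (C\<^sup>2) * emeasure lebesgue U"
      using U by (intro nn_integral_cmult_indicator) auto
    finally have "ennreal (1 / C\<^sup>2) * ennreal (1 - \<epsilon>)
        \<le> ennreal (1 / C\<^sup>2) * (ennreal (C\<^sup>2) * emeasure lebesgue U)"
      by (rule mult_left_mono) simp
    also have "\<dots> = emeasure lebesgue U"
      using C(1) by (simp add: mult.assoc[symmetric] ennreal_mult[symmetric])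
    \<comment> \<open>Pulling the product apart uses only 1 / C^2 >= 0. For \<epsilon> > 1 the
      factor 1 - \<epsilon> is negative and \<open>ennreal\<close> truncates both sides to
      0.\<close>
    finally show "emeasure lebesgue U \<ge> ennreal ((1 - \<epsilon>) * (1 / C\<^sup>2))"
      by (simp only: mult.commute ennreal_mult''[of "1 / C\<^sup>2"] zero_le_divide_1_iff zero_le_power2)
  qed
qed

end
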